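(* For all integers $n\geq 0$ and all integers $k$ with $0\leq k\leq 9$, the polynomial $\mathrm{Cat}_{n,k}(q,t)$ is jointly symmetric: $\mathrm{Cat}_{n,k}(q,t)=\mathrm{Cat}_{n,k}(t,q)$.
   Context: A Dyck vector of length $n$ is a sequence $v=(v_1,\ldots,v_n)$ of integers with $v_1=0$, all $v_i\geq 0$, and $v_{i+1}\leq v_i+1$ for all $i<n$; let $\mathrm{DV}_n$ be the set of these. Define $\mathrm{area}(v)=v_1+\cdots+v_n$, $\mathrm{dinv}(v)$ = the number of pairs $i<j$ with $v_i-v_j\in\{0,1\}$, and the deficit $\mathrm{def}(v)=\binom{n}{2}-\mathrm{area}(v)-\mathrm{dinv}(v)$. For $n,k\geq 0$ set $\mathrm{Cat}_{n,k}(q,t)=\sum_{v\in\mathrm{DV}_n,\ \mathrm{def}(v)=k} q^{\mathrm{area}(v)}t^{\mathrm{dinv}(v)}$. *)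

theory Defs
  imports "HOL-Computational_Algebra.Polynomial"
begin

text \<open>Sequences \<open>(v\<^sub>1, \<dots>, v\<^sub>n)\<close> are lists, so \<open>v\<^sub>i\<close> is \<open>v ! (i - 1)\<close>. The empty list is the only Dyck
  vector of length 0.\<close>

definition DV :: "nat \<Rightarrow> int list set" where
  "DV n = {v. length v = n \<and> (0 < n \<longrightarrow> v ! 0 = 0) \<and> (\<forall>i<n. 0 \<le> v ! i) \<and>
              (\<forall>i. i + 1 < n \<longrightarrow> v ! (i + 1) \<le> v ! i + 1)}"

definition area :: "int list \<Rightarrow> int" where
  "area v = (\<Sum>i<length v. v ! i)"

definition dinv :: "int list \<Rightarrow> nat" where
  "dinv v = card {(i, j). i < j \<and> j < length v \<and> v ! i - v ! j \<in> {0, 1}}"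

definition deficit :: "int list \<Rightarrow> int" where
  "deficit v = int (length v choose 2) - area v - int (dinv v)"

text \<open>Since \<open>area v \<ge> 0\<close> for Dyck vectors, \<open>nat\<close> does not truncate here.\<close>

definition Cat :: "nat \<Rightarrow> nat \<Rightarrow> 'a::comm_semiring_1 \<Rightarrow> 'a \<Rightarrow> 'a" where
  "Cat n k q t = (\<Sum>v | v \<in> DV n \<and> deficit v = int k. q ^ nat (area v) * t ^ dinv v)"

text \<open>The ring \<open>\<int>[q, t]\<close> is \<^typ>\<open>int poly poly\<close>, that is \<open>\<int>[q][t]\<close>; these are its two indeterminates.\<close>

definition q_var :: "int poly poly" where
  "q_var = [:[:0, 1:]:]"

definition t_var :: "int poly poly" where
  "t_var = [:0, 1:]"

lemma DV_nth_le:
  assumes "v \<in> DV n" "i < n"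
  shows "v ! i \<le> int i"
  using assms(2)
proof (induction i)
  case 0
  then show ?case using assms(1) by (simp add: DV_def)
next
  case (Suc i)
  then have "v ! Suc i \<le> v ! i + 1" using assms(1) by (simp add: DV_def)
  then show ?case using Suc by simp
qed

lemma finite_DV: "finite (DV n)"
proof (rule finite_subset)
  show "DV n \<subseteq> {v. set v \<subseteq> {0..int n} \<and> length v = n}"
  proof
    fix v assume v: "v \<in> DV n"
    then have len: "length v = n" by (simp add: DV_def)
    have "v ! i \<in> {0..int n}" if "i < n" for i
      using DV_nth_le[OF v that] v that by (simp add: DV_def)
    then show "v \<in> {v. set v \<subseteq> {0..int n} \<and> length v = n}"
      using len by (auto simp: set_conv_nth)
  qed
  show "finite {v. set v \<subseteq> {0..int n} \<and> length v = n}"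
    by (rule finite_lists_length_eq) simp
qed

lemma area_nonneg: "v \<in> DV n \<Longrightarrow> 0 \<le> area v"
  by (auto simp: area_def DV_def intro: sum_nonneg)

end

theory Submission
  imports Defs
begin

text \<open>
  Fix \<open>k\<close> and let \<open>N n a\<close> be the number of Dyck vectors of length \<open>n\<close>, deficit \<open>k\<close> and area \<open>a\<close>; their
  dinv is \<open>D n - a\<close> with \<open>D n = (n choose 2) - k\<close>. The claim is \<open>N n a = N n (D n - a)\<close>. The deficit
  counts the pairs \<open>i < j\<close> such that \<open>v\<^sub>i > v\<^sub>j + 1\<close>, or \<open>v\<^sub>i < v\<^sub>j\<close> and \<open>v\<^sub>i\<close> is not the first entry of its
  value, so a vector with small deficit is very rigid. Let \<open>n \<ge> k + 3\<close> and \<open>T = (k + 1 choose 2)\<close>.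

  Deleting the end \<open>m\<close> of the initial run \<open>0, 1, \<dots>, m\<close> and appending \<open>m - 1\<close> lowers the area by one,
  raises the dinv by one, and is injective; it is defined on all vectors of area above \<open>k\<close> and dinv
  at least \<open>T\<close>. Hence \<open>N n\<close> is weakly decreasing from area \<open>k\<close> up to the area where the dinv is \<open>T\<close>.
  For dinv at most \<open>T\<close> the map \<open>v \<mapsto> (0, v\<^sub>1 + 1, \<dots>, v\<^sub>n + 1)\<close> shows that the number of vectors of given
  dinv does not depend on \<open>n\<close>, and for area at most \<open>k\<close> and \<open>n \<ge> 2k + 1\<close> appending \<open>0\<close> shows that the
  number of vectors of given area does not depend on \<open>n\<close>.

  If the two ends of the weakly decreasing stretch carry equal values, then \<open>N n\<close> is constant between
  them, so that everything reduces to a finite enumeration: symmetry for \<open>n \<le> k + 3\<close>, constancy of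
  \<open>N (k + 3)\<close> on \<open>[k, T]\<close>, and the values at area at most \<open>k\<close> for \<open>k + 3 \<le> n \<le> 2k + 1\<close>.
\<close>

subsection \<open>Statistics of Dyck vectors\<close>

lemma DV_length: "v \<in> DV n \<Longrightarrow> length v = n"
  by (simp add: DV_def)

lemma DV_nth_0: "v \<in> DV n \<Longrightarrow> 0 < n \<Longrightarrow> v ! 0 = 0"
  by (simp add: DV_def)

lemma DV_nth_nonneg: "v \<in> DV n \<Longrightarrow> i < n \<Longrightarrow> 0 \<le> v ! i"
  by (simp add: DV_def)

lemma DV_step: "v \<in> DV n \<Longrightarrow> Suc i < n \<Longrightarrow> v ! Suc i \<le> v ! i + 1"
  by (simp add: DV_def)

lemma DV_set_nonneg: "v \<in> DV n \<Longrightarrow> x \<in> set v \<Longrightarrow> 0 \<le> x"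
  by (auto simp: DV_def in_set_conv_nth)

text \<open>Later inductions grow vectors at the end. Length 0 is separate because
  \<open>last []\<close> is unspecified there.\<close>

lemma DV_snoc:
  "v @ [c] \<in> DV (Suc n) \<longleftrightarrow> v \<in> DV n \<and> 0 \<le> c \<and> (if n = 0 then c = 0 else c \<le> last v + 1)"
proof (cases "length v = n")
  case len: True
  show ?thesis
  proof (cases n)
    case 0
    then show ?thesis using len by (auto simp: DV_def)
  next
    case (Suc m)
    have ne: "v \<noteq> []" using len Suc by auto
    have last: "last v = v ! m" using len Suc ne by (simp add: last_conv_nth)
    have nth: "(v @ [c]) ! i = v ! i" if "i < n" for i
      using that len by (simp add: nth_append)
    have nthn: "(v @ [c]) ! n = c" using len by (simp add: nth_append)
    show ?thesis
    proof
      assume L: "v @ [c] \<in> DV (Suc n)"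
      have "v ! (i + 1) \<le> v ! i + 1" if "i + 1 < n" for i
      proof -
        have "(v @ [c]) ! (i + 1) \<le> (v @ [c]) ! i + 1" using L that by (simp add: DV_def)
        then show ?thesis using that nth[of i] nth[of "i + 1"] by simp
      qed
      moreover have "0 \<le> v ! i" if "i < n" for i
        using DV_nth_nonneg[OF L, of i] that nth[of i] by simp
      moreover have "v ! 0 = 0"
      proof -
        have "(v @ [c]) ! 0 = 0" using L by (simp add: DV_def)
        then show ?thesis using nth[of 0] Suc by simp
      qed
      ultimately have "v \<in> DV n" using len by (auto simp: DV_def)
      moreover have "0 \<le> c" using DV_nth_nonneg[OF L, of n] nthn by simp
      moreover have "c \<le> last v + 1"
      proof -
        have "(v @ [c]) ! (m + 1) \<le> (v @ [c]) ! m + 1" using L Suc by (simp add: DV_def)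
        then show ?thesis using nthn nth[of m] last Suc by simp
      qed
      ultimately show "v \<in> DV n \<and> 0 \<le> c \<and> (if n = 0 then c = 0 else c \<le> last v + 1)"
        using Suc by simp
    next
      assume R: "v \<in> DV n \<and> 0 \<le> c \<and> (if n = 0 then c = 0 else c \<le> last v + 1)"
      have "(v @ [c]) ! (i + 1) \<le> (v @ [c]) ! i + 1" if "i + 1 < Suc n" for i
      proof (cases "i + 1 < n")
        case True
        moreover have "v ! (i + 1) \<le> v ! i + 1" using R True by (simp add: DV_def)
        ultimately show ?thesis using nth[of i] nth[of "i + 1"] by simp
      next
        case False
        then have "i = m" using that Suc by simp
        then show ?thesis using R nthn nth[of m] last Suc by simp
      qed
      moreover have "0 \<le> (v @ [c]) ! i" if "i < Suc n" for i
        using R that nth[of i] nthn DV_nth_nonneg[of v n i] by (cases "i = n") simp_all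
      moreover have "(v @ [c]) ! 0 = 0"
        using R nth[of 0] Suc by (simp add: DV_def)
      ultimately show "v @ [c] \<in> DV (Suc n)" using len unfolding DV_def by simp
    qed
  qed
next
  case False
  then show ?thesis by (auto simp: DV_def)
qed

lemma DV_append_left: "v @ u \<in> DV (length v + length u) \<Longrightarrow> v \<in> DV (length v)"
proof (induction u rule: rev_induct)
  case (snoc c u)
  then have "(v @ u) @ [c] \<in> DV (Suc (length v + length u))" by simp
  then show ?case using snoc.IH unfolding DV_snoc by blast
qed simp

text \<open>Entries start at 0 and rise by at most one, so no level below an attained value is
  skipped: if the appended \<open>c\<close> exceeds \<open>y\<close>, then
  \<open>last v \<ge> c - 1 \<ge> y\<close> and the induction hypothesis applies.\<close>

lemma DV_levels:
  "v \<in> DV n \<Longrightarrow> x \<in> set v \<Longrightarrow> 0 \<le> y \<Longrightarrow> y \<le> x \<Longrightarrow> y \<in> set v"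
proof (induction v arbitrary: n x rule: rev_induct)
  case (snoc c v)
  then obtain m where n: "n = Suc m" by (cases n) (auto simp: DV_def)
  have v: "v \<in> DV m" "0 \<le> c" "if m = 0 then c = 0 else c \<le> last v + 1"
    using snoc.prems(1) unfolding n DV_snoc by auto
  show ?case
  proof (cases "y = c")
    case False
    show ?thesis
    proof (cases "x \<in> set v")
      case True
      then show ?thesis using snoc.IH[OF v(1) True] snoc.prems by simp
    next
      case False
      then have "x = c" using snoc.prems(2) by simp
      then have "y < c" using \<open>y \<noteq> c\<close> snoc.prems(4) by simp
      then have "m \<noteq> 0" using v snoc.prems(3) by (auto split: if_splits)
      then have "v \<noteq> []" using DV_length[OF v(1)] by auto
      then show ?thesis
        using snoc.IH[OF v(1), of "last v"] \<open>y < c\<close> v(3) \<open>m \<noteq> 0\<close> snoc.prems(3) by simp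
    qed
  qed simp
qed simp

lemma area_conv_sum_list: "area v = sum_list v"
  by (simp add: area_def sum_list_sum_nth atLeast0LessThan)

section \<open>Dinv of concatenated lists\<close>

definition cross :: "int list \<Rightarrow> int list \<Rightarrow> nat" where
  "cross u v = (\<Sum>x\<leftarrow>u. length (filter (\<lambda>y. x - y \<in> {0, 1}) v))"

lemma cross_Nil [simp]: "cross [] v = 0" "cross u [] = 0"
  by (induction u) (simp_all add: cross_def)

lemma cross_append_left: "cross (u @ u') v = cross u v + cross u' v"
  by (simp add: cross_def)

lemma cross_append_right: "cross u (v @ w) = cross u v + cross u w"
  by (simp add: cross_def sum_list_addf)

lemma cross_single_left: "cross [x] v = length (filter (\<lambda>y. x - y \<in> {0, 1}) v)"
  by (simp add: cross_def)

lemma cross_single_right: "cross u [y] = length (filter (\<lambda>x. x - y \<in> {0, 1}) u)"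
  by (induction u) (simp_all add: cross_def)

lemma finite_dinv_set: "finite {(i, j). i < j \<and> j < length v \<and> P i j}"
  by (rule finite_subset[of _ "{..<length v} \<times> {..<length v}"]) auto

lemma dinv_Nil [simp]: "dinv [] = 0"
  by (simp add: dinv_def)

lemma dinv_Cons: "dinv (x # v) = cross [x] v + dinv v"
proof -
  let ?A = "{(i, j). i < j \<and> j < length v \<and> v ! i - v ! j \<in> {0, 1}}"
  let ?B = "{j. j < length v \<and> x - v ! j \<in> {0, 1}}"
  let ?f = "\<lambda>(i, j). (Suc i, Suc j)"
  have "{(i, j). i < j \<and> j < length (x # v) \<and> (x # v) ! i - (x # v) ! j \<in> {0, 1}}
      = (\<lambda>j. (0, Suc j)) ` ?B \<union> ?f ` ?A" (is "?L = ?R")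
  proof
    show "?L \<subseteq> ?R"
    proof
      fix p assume p: "p \<in> ?L"
      obtain i j where ij: "p = (i, j)" by force
      obtain j' where j': "j = Suc j'" using p ij by (cases j) auto
      show "p \<in> ?R"
      proof (cases i)
        case 0
        then have "j' \<in> ?B" using p ij j' by simp
        then show ?thesis using ij j' 0 by blast
      next
        case (Suc i')
        then have "(i', j') \<in> ?A" using p ij j' by simp
        then have "?f (i', j') \<in> ?f ` ?A" by (rule imageI)
        then show ?thesis using ij j' Suc by simp
      qed
    qed
    show "?R \<subseteq> ?L" by auto
  qed
  moreover have "card ((\<lambda>j. (0::nat, Suc j)) ` ?B) = card ?B"
    by (rule card_image) (auto simp: inj_on_def)
  moreover have "card (?f ` ?A) = card ?A"
    by (rule card_image) (auto simp: inj_on_def)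
  moreover have "card ((\<lambda>j. (0, Suc j)) ` ?B \<union> ?f ` ?A) =
      card ((\<lambda>j. (0::nat, Suc j)) ` ?B) + card (?f ` ?A)"
    by (rule card_Un_disjoint) (auto intro!: finite_imageI finite_dinv_set)
  ultimately show ?thesis
    by (simp add: dinv_def cross_single_left length_filter_conv_card)
qed

lemma dinv_append: "dinv (u @ v) = dinv u + dinv v + cross u v"
proof (induction u)
  case (Cons x u)
  have "cross (x # u) v = cross [x] v + cross u v"
    using cross_append_left[of "[x]" u v] by simp
  then show ?case using Cons by (simp add: dinv_Cons cross_append_right)
qed simp

lemma dinv_single [simp]: "dinv [x] = 0"
  by (simp add: dinv_Cons)

section \<open>The deficit as a number of bad pairs\<close>

definition step_cost :: "int list \<Rightarrow> int \<Rightarrow> int" where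
  "step_cost v c = int (length v) - c - int (cross v [c])"

lemma deficit_snoc: "deficit (v @ [c]) = deficit v + step_cost v c"
proof -
  have "Suc (length v) choose 2 = length v + (length v choose 2)"
    by (simp add: numeral_2_eq_2)
  then show ?thesis
    by (simp add: deficit_def step_cost_def area_conv_sum_list dinv_append)
qed

definition bad_pairs :: "int list \<Rightarrow> (nat \<times> nat) set" where
  "bad_pairs v = {(i, j). i < j \<and> j < length v \<and>
     (v ! i > v ! j + 1 \<or> v ! i < v ! j \<and> (\<exists>i'<i. v ! i' = v ! i))}"

lemma finite_bad_pairs: "finite (bad_pairs v)"
  unfolding bad_pairs_def by (rule finite_dinv_set)

lemma bad_pairs_append_iff:
  assumes "j < length v"
  shows "(i, j) \<in> bad_pairs (v @ u) \<longleftrightarrow> (i, j) \<in> bad_pairs v"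
proof (cases "i < j")
  case True
  have nth: "(v @ u) ! i' = v ! i'" if "i' \<le> j" for i'
    using that assms by (simp add: nth_append)
  have "(\<exists>i'<i. (v @ u) ! i' = (v @ u) ! i) \<longleftrightarrow> (\<exists>i'<i. v ! i' = v ! i)"
    using nth True by (metis less_imp_le order.strict_trans)
  then show ?thesis using nth[of i] nth[of j] True assms by (simp add: bad_pairs_def)
qed (simp add: bad_pairs_def)

text \<open>Among the entries smaller than a new last entry \<open>c\<close>, exactly one for each of the \<open>c\<close> lower levels
  is a first occurrence; these cancel the contribution of \<open>c\<close> to the area.\<close>

lemma step_cost_eq_card:
  assumes "v @ [c] \<in> DV (Suc n)"
  shows "step_cost v c = int (card {i. (i, n) \<in> bad_pairs (v @ [c])})"
proof -
  have v: "v \<in> DV n" "0 \<le> c" "if n = 0 then c = 0 else c \<le> last v + 1"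
    using assms unfolding DV_snoc by auto
  have len: "length v = n" using v(1) by (rule DV_length)
  let ?F = "{i. i < n \<and> v ! i < c \<and> \<not> (\<exists>i'<i. v ! i' = v ! i)}"
  let ?B = "{i. i < n \<and> (v ! i > c + 1 \<or> v ! i < c \<and> (\<exists>i'<i. v ! i' = v ! i))}"
  let ?C = "{i. i < n \<and> v ! i - c \<in> {0, 1}}"
  have "bij_betw (\<lambda>i. v ! i) ?F {0..<c}"
    unfolding bij_betw_def
  proof
    show "inj_on (\<lambda>i. v ! i) ?F"
      by (rule inj_onI) (metis (mono_tags, lifting) linorder_neqE_nat mem_Collect_eq)
    show "(\<lambda>i. v ! i) ` ?F = {0..<c}"
    proof
      show "(\<lambda>i. v ! i) ` ?F \<subseteq> {0..<c}" using DV_nth_nonneg[OF v(1)] by auto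
      show "{0..<c} \<subseteq> (\<lambda>i. v ! i) ` ?F"
      proof
        fix y assume y: "y \<in> {0..<c}"
        \<comment> \<open>Since \<open>last v \<ge> c - 1\<close>, every level below
          \<open>c\<close> already occurs in \<open>v\<close>; its least position is the
          preimage.\<close>
        then have "n \<noteq> 0" using v by (auto split: if_splits)
        then have "v \<noteq> []" using len by auto
        then have "y \<in> set v"
          using DV_levels[OF v(1), of "last v" y] y v(3) \<open>n \<noteq> 0\<close> by simp
        then have ex: "\<exists>i. i < n \<and> v ! i = y" using len by (auto simp: in_set_conv_nth)
        define i where "i = (LEAST i. i < n \<and> v ! i = y)"
        have i: "i < n" "v ! i = y" using LeastI_ex[OF ex] by (simp_all add: i_def)
        have "v ! i' \<noteq> v ! i" if "i' < i" for i'
          using not_less_Least[of i' "\<lambda>i. i < n \<and> v ! i = y"] that i unfolding i_def by auto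
        then show "y \<in> (\<lambda>i. v ! i) ` ?F" using i y by auto
      qed
    qed
  qed
  then have F: "int (card ?F) = c" using v(2) by (auto dest!: bij_betw_same_card)
  \<comment> \<open>Each earlier index is a first occurrence below \<open>c\<close>
    (\<open>c\<close> of these), forms a bad pair with \<open>n\<close>, or contributes to
    dinv.\<close>
  have "{..<n} = ?F \<union> ?B \<union> ?C" by auto
  then have "n = card (?F \<union> ?B \<union> ?C)" by (metis card_lessThan)
  also have "\<dots> = card (?F \<union> ?B) + card ?C" by (rule card_Un_disjoint) auto
  also have "card (?F \<union> ?B) = card ?F + card ?B" by (rule card_Un_disjoint) auto
  finally have "int n = c + int (card ?B) + int (card ?C)" using F by simp
  moreover have "{i. (i, n) \<in> bad_pairs (v @ [c])} = ?B"
  proof -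
    have nth: "(v @ [c]) ! i = v ! i" if "i < n" for i
      using that len by (simp add: nth_append)
    have nthn: "(v @ [c]) ! n = c" using len by (simp add: nth_append)
    have "(\<exists>i'<i. (v @ [c]) ! i' = v ! i) \<longleftrightarrow> (\<exists>i'<i. v ! i' = v ! i)" if "i < n" for i
      using nth that by (metis order.strict_trans)
    then have "(i, n) \<in> bad_pairs (v @ [c]) \<longleftrightarrow> i \<in> ?B" for i
      using nth[of i] nthn len by (cases "i < n") (simp_all add: bad_pairs_def)
    then show ?thesis by blast
  qed
  moreover have "card ?C = cross v [c]"
    using len by (simp add: cross_single_right length_filter_conv_card)
  ultimately show ?thesis by (simp add: step_cost_def len)
qed

text \<open>The deficit is the sum of the step costs of its prefixes, and a bad pair is charged to
  the step that appends its later index.\<close>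

lemma deficit_eq_card: "v \<in> DV n \<Longrightarrow> deficit v = int (card (bad_pairs v))"
proof (induction v arbitrary: n rule: rev_induct)
  case Nil
  then show ?case by (simp add: deficit_def area_def bad_pairs_def)
next
  case (snoc c v)
  obtain m where n: "n = Suc m" using snoc.prems by (cases n) (auto simp: DV_def)
  have v: "v \<in> DV m" using snoc.prems unfolding n DV_snoc by auto
  have len: "length v = m" using v by (rule DV_length)
  let ?N = "{i. (i, m) \<in> bad_pairs (v @ [c])}"
  have "bad_pairs (v @ [c]) = bad_pairs v \<union> (\<lambda>i. (i, m)) ` ?N" (is "?L = ?R")
  proof
    show "?L \<subseteq> ?R"
    proof
      fix p assume p: "p \<in> ?L"
      obtain i j where ij: "p = (i, j)" by force
      show "p \<in> ?R"
      proof (cases "j = m")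
        case False
        then have "j < length v" using p ij len by (simp add: bad_pairs_def)
        then show ?thesis using p ij bad_pairs_append_iff by blast
      qed (use p ij in auto)
    qed
    have "p \<in> ?L" if "p \<in> bad_pairs v" for p
      using that bad_pairs_append_iff[of "snd p" v "fst p" "[c]"] by (auto simp: bad_pairs_def)
    then show "?R \<subseteq> ?L" by auto
  qed
  moreover have "card (bad_pairs v \<union> (\<lambda>i. (i, m)) ` ?N) = card (bad_pairs v) + card ((\<lambda>i. (i, m)) ` ?N)"
  proof (rule card_Un_disjoint)
    have "?N \<subseteq> {..<m}" using len by (auto simp: bad_pairs_def)
    then show "finite ((\<lambda>i. (i, m)) ` ?N)"
      by (meson finite_lessThan finite_imageI finite_subset)
    show "bad_pairs v \<inter> (\<lambda>i. (i, m)) ` ?N = {}" using len by (auto simp: bad_pairs_def)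
  qed (rule finite_bad_pairs)
  moreover have "card ((\<lambda>i. (i, m)) ` ?N) = card ?N"
    by (rule card_image) (auto simp: inj_on_def)
  ultimately show ?case
    using snoc.IH[OF v] step_cost_eq_card[of v c m] snoc.prems n by (simp add: deficit_snoc)
qed

text \<open>The tool for all lower bounds on the deficit below: inject an index set into the bad
  pairs.\<close>

lemma card_le_deficit:
  assumes "v \<in> DV n" and "inj_on f I" and "f ` I \<subseteq> bad_pairs v"
  shows "int (card I) \<le> deficit v"
proof -
  have "card I = card (f ` I)" using card_image[OF assms(2)] by simp
  also have "\<dots> \<le> card (bad_pairs v)" by (rule card_mono[OF finite_bad_pairs assms(3)])
  finally show ?thesis using deficit_eq_card[OF assms(1)] by simp
qed

lemma step_cost_nonneg: "v @ [c] \<in> DV (Suc n) \<Longrightarrow> 0 \<le> step_cost v c"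
  using step_cost_eq_card by simp

subsection \<open>Vectors whose length is large compared to the deficit\<close>

text \<open>A repeated value and an entry at least two levels higher are bad in either order: the
  first clause of \<open>bad_pairs\<close> applies if the higher entry comes first, the second
  clause otherwise.\<close>

lemma bad_pair_min_max:
  assumes "x < length v" "y < length v" "v ! x + 2 \<le> v ! y" "x' < x" "v ! x' = v ! x"
  shows "(min x y, max x y) \<in> bad_pairs v"
proof (cases "x < y")
  case True
  then show ?thesis using assms by (auto simp: bad_pairs_def)
next
  case False
  moreover have "x \<noteq> y" using assms(3) by auto
  ultimately show ?thesis using assms by (simp add: bad_pairs_def)
qed

lemma min_max_eq_iff:
  fixes a b c d :: "'a::linorder"
  shows "(min a b, max a b) = (min c d, max c d) \<longleftrightarrow> (a = c \<and> b = d) \<or> (a = d \<and> b = c)"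
  by (auto simp: min_def max_def)

text \<open>Index 1 is a repeated 0, so it is bad with every positive entry. If all entries were at
  most 1, the area would count these pairs and could not exceed the deficit. So some entry
  \<open>p\<close> is at least 2, and each of the indices from 2 on yields its own bad pair.\<close>

lemma length_le_if_starts_00:
  assumes v: "v \<in> DV n" and n: "2 \<le> n" and v1: "v ! 1 = 0" and area: "deficit v < area v"
  shows "int n \<le> deficit v + 2"
proof -
  have len: "length v = n" using v by (rule DV_length)
  have v0: "v ! 0 = 0" using DV_nth_0[OF v] n by simp
  have pos: "(1, j) \<in> bad_pairs v" if "j < n" "0 < v ! j" for j
  proof -
    have "j \<noteq> 0" "j \<noteq> 1" using that v0 v1 by (auto intro: ccontr)
    then show ?thesis using that len v0 v1 by (auto simp: bad_pairs_def intro!: exI[of _ 0])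
  qed
  have "\<exists>p<n. 2 \<le> v ! p"
  proof (rule ccontr)
    assume "\<not> (\<exists>p<n. 2 \<le> v ! p)"
    then have le1: "v ! i \<le> 1" if "i < n" for i using that by force
    let ?J = "{j. j < n \<and> 0 < v ! j}"
    have "area v = (\<Sum>i<n. if 0 < v ! i then 1 else 0)"
      unfolding area_def len
    proof (rule sum.cong)
      fix i assume "i \<in> {..<n}"
      then show "v ! i = (if 0 < v ! i then 1 else 0)"
        using le1[of i] DV_nth_nonneg[OF v, of i] by auto
    qed simp
    also have "\<dots> = int (card ({..<n} \<inter> {i. 0 < v ! i}))"
      by (simp add: sum.If_cases)
    also have "{..<n} \<inter> {i. 0 < v ! i} = ?J" by auto
    finally have "area v = int (card ?J)" .
    moreover have "int (card ?J) \<le> deficit v"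
      by (rule card_le_deficit[OF v, of "\<lambda>j. (1, j)"]) (use pos in \<open>auto simp: inj_on_def\<close>)
    ultimately show False using area by simp
  qed
  then obtain p where p: "p < n" "2 \<le> v ! p" by auto
  have p01: "2 \<le> p"
  proof (rule ccontr)
    assume "\<not> 2 \<le> p"
    then have "p = 0 \<or> p = 1" by auto
    then show False using p v0 v1 by auto
  qed
  \<comment> \<open>Zeros are paired with \<open>p\<close>, positive entries with index 1. The two
    kinds cannot collide because the first component is above 1 in the first kind.\<close>
  let ?f = "\<lambda>i. if v ! i = 0 then (min i p, max i p) else (1, i)"
  have "int (card {2..<n}) \<le> deficit v"
  proof (rule card_le_deficit[OF v])
    show "inj_on ?f {2..<n}"
    proof (rule inj_onI)
      fix i j assume ij: "i \<in> {2..<n}" "j \<in> {2..<n}" "?f i = ?f j"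
      have 1: "1 < min i' p" if "i' \<in> {2..<n}" for i' using that p01 by simp
      show "i = j"
        using ij 1[OF ij(1)] 1[OF ij(2)] by (auto simp: min_max_eq_iff split: if_splits)
    qed
    show "?f ` {2..<n} \<subseteq> bad_pairs v"
    proof
      fix q assume "q \<in> ?f ` {2..<n}"
      then obtain i where i: "2 \<le> i" "i < n" "q = ?f i" by auto
      show "q \<in> bad_pairs v"
      proof (cases "v ! i = 0")
        case True
        then have "(min i p, max i p) \<in> bad_pairs v"
          using bad_pair_min_max[of i v p 0] i p len v0 by simp
        then show ?thesis using i True by simp
      next
        case False
        then have "0 < v ! i" using DV_nth_nonneg[OF v i(2)] by simp
        then show ?thesis using pos[OF i(2)] i(3) by simp
      qed
    qed
  qed
  then show ?thesis using n by simp
qed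

text \<open>Only three indices are given up: 0, the first 1 at \<open>e\<close>, and
  \<open>p\<close>. Any other entry at most 1 is a repetition and is bad with \<open>p\<close>; any
  entry at least 2 is bad with the second zero \<open>z\<close>.\<close>

lemma length_le_if_zero_and_three:
  assumes v: "v \<in> DV n" and z: "0 < z" "z < n" "v ! z = 0" and p: "p < n" "3 \<le> v ! p"
  shows "int n \<le> deficit v + 3"
proof -
  have len: "length v = n" using v by (rule DV_length)
  have v0: "v ! 0 = 0" using DV_nth_0[OF v] z by simp
  have "1 \<in> set v"
    by (rule DV_levels[OF v, of "v ! p"]) (use p len in auto)
  then have ex: "\<exists>i. i < n \<and> v ! i = 1" using len by (auto simp: in_set_conv_nth)
  define e where "e = (LEAST i. i < n \<and> v ! i = 1)"
  have e: "e < n" "v ! e = 1" using LeastI_ex[OF ex] by (simp_all add: e_def)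
  have e_min: "e \<le> i" if "i < n" "v ! i = 1" for i
    unfolding e_def using that by (simp add: Least_le)
  have zp: "z \<noteq> p" using z p by auto
  let ?I = "{..<n} - {0, e, p}"
  let ?f = "\<lambda>i. if v ! i \<le> 1 then (min i p, max i p) else (min z i, max z i)"
  have "int (card ?I) \<le> deficit v"
  proof (rule card_le_deficit[OF v])
    show "inj_on ?f ?I"
    proof (rule inj_onI)
      fix i j assume ij: "i \<in> ?I" "j \<in> ?I" "?f i = ?f j"
      show "i = j" using ij zp by (auto simp: min_max_eq_iff split: if_splits)
    qed
    show "?f ` ?I \<subseteq> bad_pairs v"
    proof
      fix q assume "q \<in> ?f ` ?I"
      then obtain i where "i \<in> ?I" and q: "q = ?f i" by blast
      then have i: "i < n" "i \<noteq> 0" "i \<noteq> e" "i \<noteq> p" by auto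
      show "q \<in> bad_pairs v"
      proof (cases "v ! i \<le> 1")
        case True
        then have "v ! i = 0 \<or> v ! i = 1" using DV_nth_nonneg[OF v i(1)] by auto
        then have "\<exists>i'<i. v ! i' = v ! i"
        proof
          assume "v ! i = 0"
          then show ?thesis using v0 i(2) by auto
        next
          assume "v ! i = 1"
          then show ?thesis using e e_min[OF i(1)] i(3) by (metis le_neq_implies_less)
        qed
        then obtain i' where "i' < i" "v ! i' = v ! i" by blast
        then have "(min i p, max i p) \<in> bad_pairs v"
          using bad_pair_min_max[of i v p i'] i p len True by simp
        then show ?thesis using True q by simp
      next
        case False
        then have "(min z i, max z i) \<in> bad_pairs v"
          using bad_pair_min_max[of z v i 0] i z len v0 by simp
        then show ?thesis using False q by simp
      qed
    qed
  qed
  moreover have "int n - 3 \<le> int (card ?I)"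
  proof -
    have "card {..<n} - card {0, e, p} \<le> card ?I" by (rule diff_card_le_card_Diff) simp
    moreover have "card {0, e, p} \<le> 3" by (simp add: card_insert_if)
    ultimately show ?thesis by simp
  qed
  ultimately show ?thesis by simp
qed

text \<open>A second zero forces all entries to be at most 2 at this length, and each 2 is bad with
  \<open>z\<close>. Contrapositively, a vector of large area has a single zero, so it can be lowered
  by one after removing its head.\<close>

lemma area_le_if_second_zero:
  assumes v: "v \<in> DV n" and z: "0 < z" "z < n" "v ! z = 0" and n: "deficit v + 4 \<le> int n"
  shows "area v \<le> int n - 2 + deficit v"
proof -
  have len: "length v = n" using v by (rule DV_length)
  have v0: "v ! 0 = 0" using DV_nth_0[OF v] z by simp
  have le2: "v ! i \<le> 2" if "i < n" for i
    using length_le_if_zero_and_three[OF v z that] n by force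
  let ?T = "{i. i < n \<and> v ! i = 2}"
  have "int (card ?T) \<le> deficit v"
  proof (rule card_le_deficit[OF v])
    show "inj_on (\<lambda>i. (min z i, max z i)) ?T"
      by (rule inj_onI) (auto simp: min_max_eq_iff)
    show "(\<lambda>i. (min z i, max z i)) ` ?T \<subseteq> bad_pairs v"
      using bad_pair_min_max[of z v _ 0] z len v0 by auto
  qed
  moreover have "area v \<le> int n - 2 + int (card ?T)"
  proof -
    have "area v = (\<Sum>i\<in>{..<n} - {0, z}. v ! i)"
      unfolding area_def len using v0 z by (intro sum.mono_neutral_right) auto
    also have "\<dots> \<le> (\<Sum>i\<in>{..<n} - {0, z}. 1 + (if v ! i = 2 then 1 else 0))"
    proof (rule sum_mono)
      fix i assume "i \<in> {..<n} - {0, z}"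
      then show "v ! i \<le> 1 + (if v ! i = 2 then 1 else 0)" using le2[of i] by simp
    qed
    also have "\<dots> = int (card ({..<n} - {0, z})) + int (card (({..<n} - {0, z}) \<inter> {i. v ! i = 2}))"
      by (simp add: sum.distrib sum.If_cases)
    also have "card ({..<n} - {0, z}) = n - 2"
      using z by (subst card_Diff_subset) auto
    also have "({..<n} - {0, z}) \<inter> {i. v ! i = 2} = ?T" using v0 z by auto
    finally show ?thesis using z by simp
  qed
  ultimately show ?thesis by simp
qed

text \<open>If the last entry is too low for moving the run end \<open>m\<close>, many bad pairs
  arise, so few entries follow the run. As the run has no dinv pairs of its own, dinv is then
  small.\<close>

lemma dinv_bound_if_low_end:
  assumes w: "w \<in> DV n" and run: "\<And>i. i \<le> m \<Longrightarrow> w ! i = int i" and m: "m < n - 1"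
    and low: "w ! (n - 1) + 3 \<le> int m"
  shows "int (n - m) \<le> deficit w" and "dinv w \<le> 2 * (n - 1 - m) + (n - 1 - m choose 2)"
proof -
  have len: "length w = n" using w by (rule DV_length)
  have low0: "0 \<le> w ! (n - 1)" using DV_nth_nonneg[OF w, of "n - 1"] m by simp
  have m3: "3 \<le> m" using low low0 by simp
  let ?I = "{m - 1..<n - 1}"
  let ?f = "\<lambda>i. if i \<le> m \<or> int m - 1 \<le> w ! i then (i, n - 1) else (m, i)"
  have "int (card ?I) \<le> deficit w"
  proof (rule card_le_deficit[OF w])
    show "inj_on ?f ?I" by (rule inj_onI) (auto split: if_splits)
    show "?f ` ?I \<subseteq> bad_pairs w"
    proof
      fix q assume "q \<in> ?f ` ?I"
      then obtain i where i: "m - 1 \<le> i" "i < n - 1" "q = ?f i" by auto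
      show "q \<in> bad_pairs w"
      proof (cases "i \<le> m \<or> int m - 1 \<le> w ! i")
        \<comment> \<open>Here \<open>w ! i \<ge> m - 1\<close> is at least two above the last
          entry; in the other case \<open>w ! i \<le> m - 2\<close> is at least two below
          \<open>w ! m\<close>.\<close>
        case True
        then have "int m - 1 \<le> w ! i" using i run[of i] m3 by auto
        then show ?thesis using True i len low m by (simp add: bad_pairs_def)
      next
        case False
        then have "m < i" "w ! i + 1 < w ! m" using run[of m] by auto
        then show ?thesis using False i len m by (auto simp: bad_pairs_def)
      qed
    qed
  qed
  moreover have "card ?I = n - m" using m m3 by simp
  ultimately show "int (n - m) \<le> deficit w" by simp
  let ?D = "{(i, j). i < j \<and> j < n \<and> w ! i - w ! j \<in> {0, 1}}"
  let ?J = "{m<..<n}"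
  \<comment> \<open>In the run, index and value agree, so each later \<open>j\<close> has at most
    two dinv partners there, at the indices \<open>w ! j\<close> and \<open>w ! j + 1\<close>.
    \<open>?C\<close> holds the pairs beyond the run.\<close>
  let ?A = "(\<lambda>j. (nat (w ! j), j)) ` ?J" and ?B = "(\<lambda>j. (nat (w ! j) + 1, j)) ` ?J"
  let ?C = "{(i, j). m < i \<and> i < j \<and> j < n}"
  have cardC: "card ?C = n - 1 - m choose 2"
  proof -
    have "bij_betw (\<lambda>(i, j). {i, j}) ?C {K. K \<subseteq> ?J \<and> card K = 2}"
      unfolding bij_betw_def
    proof
      show "inj_on (\<lambda>(i, j). {i, j}) ?C" by (auto simp: inj_on_def doubleton_eq_iff)
      show "(\<lambda>(i, j). {i, j}) ` ?C = {K. K \<subseteq> ?J \<and> card K = 2}"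
      proof
        show "(\<lambda>(i, j). {i, j}) ` ?C \<subseteq> {K. K \<subseteq> ?J \<and> card K = 2}" by auto
        show "{K. K \<subseteq> ?J \<and> card K = 2} \<subseteq> (\<lambda>(i, j). {i, j}) ` ?C"
        proof
          fix K assume K: "K \<in> {K. K \<subseteq> ?J \<and> card K = 2}"
          then obtain a b where ab: "K = {a, b}" "a \<noteq> b" by (auto simp: card_2_iff)
          then have "(min a b, max a b) \<in> ?C" using K by (auto simp: min_def max_def)
          moreover have "K = (\<lambda>(i, j). {i, j}) (min a b, max a b)"
            using ab by (auto simp: min_def max_def)
          ultimately show "K \<in> (\<lambda>(i, j). {i, j}) ` ?C" by (rule rev_image_eqI)
        qed
      qed
    qed
    then have "card ?C = card {K. K \<subseteq> ?J \<and> card K = 2}" by (rule bij_betw_same_card)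
    also have "\<dots> = card ?J choose 2" by (rule n_subsets) simp
    finally show ?thesis by simp
  qed
  have "?D \<subseteq> ?A \<union> ?B \<union> ?C"
  proof
    fix q assume "q \<in> ?D"
    then obtain i j where ij: "q = (i, j)" "i < j" "j < n" "w ! i - w ! j \<in> {0, 1}" by auto
    have j: "m < j"
    proof (rule ccontr)
      assume "\<not> m < j"
      then have "w ! i = int i" "w ! j = int j" using run ij by auto
      then show False using ij by auto
    qed
    show "q \<in> ?A \<union> ?B \<union> ?C"
    proof (cases "m < i")
      case True
      then show ?thesis using ij by simp
    next
      case False
      then have "w ! i = int i" using run by simp
      then have "i = nat (w ! j) \<or> i = nat (w ! j) + 1"
        using ij(4) DV_nth_nonneg[OF w ij(3)] by auto
      then show ?thesis using ij j by auto
    qed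
  qed
  moreover have "finite ?C" by (rule finite_subset[of _ "{..<n} \<times> {..<n}"]) auto
  ultimately have "card ?D \<le> card (?A \<union> ?B \<union> ?C)" by (intro card_mono) auto
  also have "\<dots> \<le> card ?A + card ?B + card ?C"
    by (meson add_le_mono card_Un_le le_refl order_trans)
  also have "\<dots> \<le> card ?J + card ?J + card ?C"
    by (intro add_mono card_image_le) auto
  finally show "dinv w \<le> 2 * (n - 1 - m) + (n - 1 - m choose 2)"
    by (simp add: dinv_def len cardC)
qed

subsection \<open>Comparing the numbers of vectors of given area\<close>

definition level :: "nat \<Rightarrow> nat \<Rightarrow> int \<Rightarrow> int list set" where
  "level n k a = {v \<in> DV n. deficit v = int k \<and> area v = a}"

lemma finite_level: "finite (level n k a)"
  unfolding level_def using finite_DV by simp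

lemma levelD:
  assumes "v \<in> level n k a"
  shows "v \<in> DV n" "deficit v = int k" "area v = a"
    "int (dinv v) = int (n choose 2) - int k - a" "length v = n"
  using assms by (auto simp: level_def deficit_def DV_def)

text \<open>Moving the end \<open>m\<close> of the initial run \<open>0, 1, \<dots>, m\<close> to the end of the vector, lowered by one, is
  injective: \<open>m\<close> can be read off the new last entry.\<close>

lemma move_run_end:
  assumes w: "w \<in> DV n" and run: "\<And>i. i \<le> m \<Longrightarrow> w ! i = int i" and m: "0 < m" "m < n"
    and nxt: "m + 1 < n \<Longrightarrow> w ! (m + 1) \<le> int m" and last: "int m \<le> w ! (n - 1) + 2"
    and v: "v = map int [0..<m] @ drop (Suc m) w @ [int m - 1]"
  shows "v \<in> DV n" "area v = area w - 1" "dinv v = dinv w + 1"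
    "w = map int [0..<Suc m] @ drop (Suc m) w"
proof -
  have len: "length w = n" using w by (rule DV_length)
  let ?x = "drop (Suc m) w"
  show weq: "w = map int [0..<Suc m] @ ?x"
  proof (rule nth_equalityI)
    show "length w = length (map int [0..<Suc m] @ ?x)" using len m by simp
    fix i assume "i < length w"
    then show "w ! i = (map int [0..<Suc m] @ ?x) ! i"
      using run[of i] len m by (cases "i \<le> m") (simp_all add: nth_append del: upt_Suc)
  qed
  obtain m' where m': "m = Suc m'" using m by (cases m) auto
  have "sum_list w = sum_list (map int [0..<m]) + int m + sum_list ?x"
    by (subst weq) simp
  then show "area v = area w - 1"
    by (simp add: v area_conv_sum_list)
  show "dinv v = dinv w + 1"
  proof -
    let ?u = "map int [0..<m]"
    have "dinv w = dinv (?u @ [int m] @ ?x)" by (subst weq) simp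
    also have "\<dots> = dinv ?u + dinv ?x + cross ?u ?x + cross ?u [int m] + cross [int m] ?x"
      by (simp only: dinv_append dinv_single cross_append_right)
    also have "cross ?u [int m] = 0"
      by (auto simp: cross_single_right filter_empty_conv)
    finally have 1: "dinv w = dinv ?u + dinv ?x + cross ?u ?x + cross [int m] ?x" by simp
    have 2: "dinv v = dinv ?u + dinv ?x + cross ?u ?x + cross ?u [int m - 1] + cross ?x [int m - 1]"
      by (simp only: v dinv_append dinv_single cross_append_right)
    have "cross (map int [0..<m']) [int m'] = 0"
      by (auto simp: cross_single_right filter_empty_conv)
    then have 3: "cross ?u [int m - 1] = 1"
      by (simp add: m' cross_append_left cross_single_left)
    \<comment> \<open>Both sides count the entries \<open>m - 1\<close> and \<open>m\<close> of the
      tail, so the only dinv gained is the pair of the two entries \<open>m - 1\<close>.\<close>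
    have "cross ?x [int m - 1] = cross [int m] ?x"
      unfolding cross_single_right cross_single_left
      by (rule arg_cong[of _ _ length], rule filter_cong) auto
    then show ?thesis using 1 2 3 by simp
  qed
  have lenv: "length v = n" using len m by (simp add: v)
  have v1: "v ! i = int i" if "i < m" for i using that by (simp add: v nth_append)
  have v2: "v ! i = w ! (i + 1)" if "m \<le> i" "i < n - 1" for i
    using that len by (auto simp: v nth_append)
  have v3: "v ! (n - 1) = int m - 1"
  proof -
    have "v = (map int [0..<m] @ ?x) @ [int m - 1]" by (simp add: v)
    moreover have "n - 1 = length (map int [0..<m] @ ?x)" using len m by simp
    ultimately show ?thesis by (metis nth_append_length)
  qed
  show "v \<in> DV n"
    unfolding DV_def
  proof (intro CollectI conjI allI impI)
    show "length v = n" by (rule lenv)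
    show "v ! 0 = 0" using v1 m by simp
    show "0 \<le> v ! i" if "i < n" for i
    proof -
      have "i < m \<or> m \<le> i \<and> i < n - 1 \<or> i = n - 1" using that by linarith
      then consider "i < m" | "m \<le> i" "i < n - 1" | "i = n - 1" by blast
      then show ?thesis
      proof cases
        case 2
        then show ?thesis using v2 DV_nth_nonneg[OF w, of "i + 1"] by simp
      qed (use v1 v3 m in auto)
    qed
    show "v ! (i + 1) \<le> v ! i + 1" if i: "i + 1 < n" for i
    proof -
      have "i + 1 < m \<or> i + 1 = m \<and> m < n - 1 \<or> i + 1 = m \<and> m = n - 1
        \<or> m \<le> i \<and> i + 1 < n - 1 \<or> m \<le> i \<and> i + 1 = n - 1" using i m by linarith
      then consider "i + 1 < m" | "i + 1 = m" "m < n - 1" | "i + 1 = m" "m = n - 1"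
        | "m \<le> i" "i + 1 < n - 1" | "m \<le> i" "i + 1 = n - 1" by blast
      then show ?thesis
      proof cases
        case 1
        then show ?thesis using v1[of i] v1[of "i + 1"] by simp
      next
        case 2
        then have "v ! (i + 1) = w ! (m + 1)" "w ! (m + 1) \<le> int m"
          using v2[of m] nxt by simp_all
        then show ?thesis using 2(1) v1[of i] by simp
      next
        case 3
        then show ?thesis using v1[of i] v3 by simp
      next
        case 4
        then have "w ! ((i + 1) + 1) \<le> w ! (i + 1) + 1" using w unfolding DV_def by simp
        then show ?thesis using 4 v2[of i] v2[of "i + 1"] by simp
      next
        case 5
        then show ?thesis using v2[of i] v3 last by simp
      qed
    qed
  qed
qed

lemma choose_two_mono: "m \<le> n \<Longrightarrow> m choose 2 \<le> n choose 2"
  by (rule binomial_right_mono)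

text \<open>The upper bound on \<open>a\<close> says that dinv is at least
  \<open>Suc k choose 2\<close>. Injectivity of moving the run end is expressed by a left inverse
  \<open>Q\<close> that maps the lower level onto a superset of the upper one.\<close>

lemma card_level_le:
  assumes n: "k + 3 \<le> n" and a: "int k < a" "a + int k + int (Suc k choose 2) \<le> int (n choose 2)"
  shows "card (level n k a) \<le> card (level n k (a - 1))"
proof -
  \<comment> \<open>The appended entry is \<open>m - 1\<close>, so \<open>m\<close> is
    \<open>last v + 1\<close>; dropping the shortened run and the last entry leaves the untouched
    tail.\<close>
  define Q where "Q v = (let m = nat (last v) + 1 in map int [0..<Suc m] @ butlast (drop m v))" for v
  have "level n k a \<subseteq> Q ` level n k (a - 1)"
  proof
    fix w assume w: "w \<in> level n k a"
    note wD = levelD[OF w]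
    define M where "M = {m. m < n \<and> (\<forall>i\<le>m. w ! i = int i)}"
    define m where "m = Max M"
    have w0: "w ! 0 = 0" using DV_nth_0[OF wD(1)] n by simp
    have "w ! 1 \<noteq> 0"
      using length_le_if_starts_00[OF wD(1)] wD(2,3) a n by auto
    moreover have "w ! 1 \<le> w ! 0 + 1" using DV_step[OF wD(1), of 0] n by simp
    moreover have "0 \<le> w ! 1" using DV_nth_nonneg[OF wD(1), of 1] n by simp
    ultimately have w1: "w ! 1 = 1" using w0 by simp
    have "w ! i = int i" if "i \<le> 1" for i
      using w0 w1 that by (cases i) auto
    then have M1: "1 \<in> M" using n by (auto simp: M_def)
    have finM: "finite M" by (simp add: M_def)
    have mM: "m \<in> M" unfolding m_def using finM M1 by (intro Max_in) auto
    then have mn: "m < n" and run: "\<And>i. i \<le> m \<Longrightarrow> w ! i = int i" by (auto simp: M_def)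
    have m0: "0 < m" using Max_ge[OF finM M1] by (simp add: m_def)
    have nxt: "w ! (m + 1) \<le> int m" if "m + 1 < n"
    proof -
      have "Suc m \<notin> M" using Max_ge[OF finM, of "Suc m"] by (auto simp: m_def)
      then have "w ! (m + 1) \<noteq> int (m + 1)"
        using that run by (auto simp: M_def le_Suc_eq)
      moreover have "w ! (m + 1) \<le> w ! m + 1" using wD(1) that unfolding DV_def by simp
      ultimately show ?thesis using run[of m] by simp
    qed
    have last: "int m \<le> w ! (n - 1) + 2"
    proof (rule ccontr)
      assume "\<not> int m \<le> w ! (n - 1) + 2"
      then have low: "w ! (n - 1) + 3 \<le> int m" by simp
      have "m \<noteq> n - 1" using low run[of m] by auto
      then have "m < n - 1" using mn by simp
      note b = dinv_bound_if_low_end[OF wD(1) run this low]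
      \<comment> \<open>The bad pairs give \<open>n - m \<le> k\<close>. With
        \<open>k = Suc l\<close> the resulting bound \<open>2 * l + (l choose 2)\<close> on dinv is
        one less than \<open>Suc k choose 2\<close>.\<close>
      have r: "n - 1 - m \<le> k - 1" "1 \<le> k" using b(1) wD(2) mn by auto
      have "dinv w \<le> 2 * (k - 1) + (k - 1 choose 2)"
        using b(2) r(1) choose_two_mono[OF r(1)] by linarith
      also have "\<dots> < Suc k choose 2"
      proof -
        obtain l where "k = Suc l" using r(2) by (cases k) auto
        then show ?thesis by (simp add: numeral_2_eq_2)
      qed
      finally show False using wD(4) a by linarith
    qed
    define v where "v = map int [0..<m] @ drop (Suc m) w @ [int m - 1]"
    note vv = move_run_end[OF wD(1) run m0 mn nxt last v_def]
    have "v \<in> level n k (a - 1)"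
      using vv wD by (simp add: level_def deficit_def DV_length)
    moreover have "Q v = w"
    proof -
      have "nat (last v) + 1 = m" using m0 by (simp add: v_def)
      moreover have "butlast (drop m v) = drop (Suc m) w" by (simp add: v_def)
      ultimately show ?thesis using vv(4) by (simp add: Q_def)
    qed
    ultimately show "w \<in> Q ` level n k (a - 1)" by blast
  qed
  then show ?thesis using finite_level by (metis surj_card_le)
qed

section \<open>Independence of the length for small dinv\<close>

lemma cross_map_add: "cross (map (\<lambda>x. x + c) u) (map (\<lambda>x. x + c) v) = cross u v"
  by (simp add: cross_def o_def filter_map)

lemma dinv_map_add: "dinv (map (\<lambda>x. x + c) v) = dinv v"
proof (induction v)
  case (Cons x v)
  then show ?case using cross_map_add[of c "[x]" v] by (simp add: dinv_Cons)
qed simp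

text \<open>Raising all entries and prepending 0 adds \<open>n\<close> both to the area and to the
  binomial and keeps dinv, as the new 0 lies below everything. The hypothesis on \<open>a\<close>
  bounds dinv by \<open>Suc k choose 2\<close> and is needed for surjectivity.\<close>

lemma card_level_shift:
  assumes n: "k + 3 \<le> n" and a: "int (n choose 2) \<le> a + int k + int (Suc k choose 2)"
  shows "card (level (Suc n) k (a + int n)) = card (level n k a)"
proof -
  let ?f = "\<lambda>v. 0 # map (\<lambda>x. x + 1) v :: int list"
  have choose: "Suc n choose 2 = n + (n choose 2)" by (simp add: numeral_2_eq_2)
  have sum: "sum_list (map (\<lambda>x. x + 1) v) = sum_list v + int (length v)" for v :: "int list"
    by (induction v) auto
  have dinv: "dinv (?f v) = dinv v" if "\<And>x. x \<in> set v \<Longrightarrow> 0 \<le> x" for v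
  proof -
    have "filter (\<lambda>y. 0 - y \<in> {0, 1}) (map (\<lambda>x. x + 1) v) = []"
      using that by (force simp: filter_empty_conv)
    then show ?thesis by (simp add: dinv_Cons cross_single_left dinv_map_add del: diff_0)
  qed
  have "level (Suc n) k (a + int n) = ?f ` level n k a"
  proof
    show "?f ` level n k a \<subseteq> level (Suc n) k (a + int n)"
    proof
      fix w assume "w \<in> ?f ` level n k a"
      then obtain v where v: "v \<in> level n k a" "w = ?f v" by blast
      note vD = levelD[OF v(1)]
      have "?f v \<in> DV (Suc n)"
        unfolding DV_def
      proof (intro CollectI conjI allI impI)
        show "length (?f v) = Suc n" using vD(5) by simp
        show "?f v ! 0 = 0" by simp
        show "0 \<le> ?f v ! i" if "i < Suc n" for i
          using that DV_nth_nonneg[OF vD(1), of "i - 1"] vD(5) by (cases i) auto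
        show "?f v ! (i + 1) \<le> ?f v ! i + 1" if i: "i + 1 < Suc n" for i
        proof (cases i)
          case 0
          then show ?thesis using i DV_nth_0[OF vD(1)] vD(5) by simp
        next
          case (Suc j)
          then have "v ! (j + 1) \<le> v ! j + 1" using i vD(1) unfolding DV_def by simp
          then show ?thesis using Suc i vD(5) by simp
        qed
      qed
      moreover have "dinv (?f v) = dinv v"
        by (rule dinv) (rule DV_set_nonneg[OF vD(1)])
      ultimately show "w \<in> level (Suc n) k (a + int n)"
        using vD sum[of v] unfolding v(2) level_def
        by (simp add: deficit_def area_conv_sum_list choose)
    qed
    show "level (Suc n) k (a + int n) \<subseteq> ?f ` level n k a"
    proof
      fix w assume w: "w \<in> level (Suc n) k (a + int n)"
      note wD = levelD[OF w]
      \<comment> \<open>A second zero would bound the area so that \<open>a \<le> k - 1\<close>,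
        which makes \<open>n choose 2\<close> smaller than \<open>(k + 3) choose 2\<close>.\<close>
      have pos: "w ! z \<noteq> 0" if z: "0 < z" "z < Suc n" for z
      proof
        assume "w ! z = 0"
        then have "area w \<le> int (Suc n) - 2 + int k"
          using area_le_if_second_zero[OF wD(1) z] wD(2) n by simp
        then have "a \<le> int k - 1" using wD(3) by simp
        then have "n choose 2 < 2 * k + (Suc k choose 2)" using a by linarith
        moreover have "(k + 3) choose 2 \<le> n choose 2" by (rule choose_two_mono[OF n])
        moreover have "(k + 3) choose 2 = 2 * k + (Suc k choose 2) + 3"
          by (simp add: numeral_2_eq_2 numeral_3_eq_3)
        ultimately show False by simp
      qed
      obtain x u where w_eq: "w = x # u" using wD(5) by (cases w) auto
      have x: "x = 0" using DV_nth_0[OF wD(1)] w_eq by simp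
      have lenu: "length u = n" using wD(5) w_eq by simp
      have u1: "1 \<le> u ! i" if "i < n" for i
        using pos[of "Suc i"] DV_nth_nonneg[OF wD(1), of "Suc i"] that w_eq by simp
      define v where "v = map (\<lambda>x. x - 1) u"
      have wv: "w = ?f v" by (simp add: w_eq x v_def o_def)
      have nth_v: "v ! i = w ! Suc i - 1" if "i < n" for i
        using that lenu by (simp add: v_def w_eq)
      have v: "v \<in> DV n"
        unfolding DV_def
      proof (intro CollectI conjI allI impI)
        show "length v = n" using lenu by (simp add: v_def)
        show "0 \<le> v ! i" if "i < n" for i using u1[OF that] that lenu by (simp add: v_def)
        then have "0 \<le> v ! 0" using n by simp
        moreover have "w ! Suc 0 \<le> w ! 0 + 1" using DV_step[OF wD(1), of 0] n by simp
        ultimately show "v ! 0 = 0" using nth_v[of 0] n w_eq x by simp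
        show "v ! (i + 1) \<le> v ! i + 1" if "i + 1 < n" for i
        proof -
          have "w ! (Suc i + 1) \<le> w ! Suc i + 1" using wD(1) that unfolding DV_def by simp
          then show ?thesis using nth_v[of i] nth_v[of "i + 1"] that by simp
        qed
      qed
      have "dinv w = dinv v" unfolding wv by (rule dinv) (rule DV_set_nonneg[OF v])
      moreover have "area w = area v + int n"
        unfolding wv area_conv_sum_list using sum[of v] DV_length[OF v] by simp
      ultimately have "v \<in> level n k a"
        using v wD DV_length[OF v] by (simp add: level_def deficit_def choose)
      then show "w \<in> ?f ` level n k a" using wv by blast
    qed
  qed
  moreover have "inj ?f" by (rule injI) (simp add: inj_map_eq_map inj_def)
  ultimately show ?thesis by (simp add: card_image inj_on_subset)
qed

section \<open>Independence of the length for small area\<close>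

text \<open>Every zero except the first is a repetition and is bad with \<open>p\<close>, whether
  \<open>p\<close> is two levels up or merely a positive last entry. So there are at most
  \<open>1 + deficit v\<close> zeros.\<close>

lemma length_le_nonzeros:
  assumes v: "v \<in> DV n" and p: "p < n" "2 \<le> v ! p \<or> (p = n - 1 \<and> 0 < v ! p)"
  shows "int n \<le> 1 + deficit v + int (card {i. i < n \<and> 0 < v ! i})"
proof -
  have len: "length v = n" using v by (rule DV_length)
  have v0: "v ! 0 = 0" using DV_nth_0[OF v] p by simp
  let ?Z = "{i. 0 < i \<and> i < n \<and> v ! i = 0}" and ?U = "{i. i < n \<and> 0 < v ! i}"
  have "int (card ?Z) \<le> deficit v"
  proof (rule card_le_deficit[OF v])
    show "inj_on (\<lambda>i. (min i p, max i p)) ?Z"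
      by (rule inj_onI) (auto simp: min_max_eq_iff)
    have "(min i p, max i p) \<in> bad_pairs v" if i: "i \<in> ?Z" for i
    proof (cases "2 \<le> v ! p")
      case True
      then show ?thesis using bad_pair_min_max[of i v p 0] i p len v0 by simp
    next
      case False
      then have "p = n - 1" "0 < v ! p" using p by auto
      moreover have "i \<noteq> p" using i \<open>0 < v ! p\<close> by auto
      ultimately have "i < p" using i by (simp, linarith)
      then show ?thesis using i \<open>0 < v ! p\<close> p len v0 by (auto simp: bad_pairs_def)
    qed
    then show "(\<lambda>i. (min i p, max i p)) ` ?Z \<subseteq> bad_pairs v" by auto
  qed
  moreover have "n \<le> 1 + card ?Z + card ?U"
  proof -
    have "{..<n} \<subseteq> {0} \<union> ?Z \<union> ?U" using DV_nth_nonneg[OF v] by (auto simp: order_le_less)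
    then have "card {..<n} \<le> card ({0} \<union> ?Z \<union> ?U)" by (intro card_mono) auto
    also have "\<dots> \<le> card {0::nat} + card ?Z + card ?U"
      by (meson add_le_mono card_Un_le le_refl order_trans)
    finally show ?thesis by simp
  qed
  ultimately show ?thesis by simp
qed

lemma card_nonzero_le_area:
  assumes v: "v \<in> DV n"
  shows "int (card {i. i < n \<and> 0 < v ! i}) \<le> area v"
    and "p < n \<Longrightarrow> 2 \<le> v ! p \<Longrightarrow> int (card {i. i < n \<and> 0 < v ! i}) < area v"
proof -
  let ?U = "{i. i < n \<and> 0 < v ! i}"
  have area: "area v = (\<Sum>i\<in>?U. v ! i)"
    unfolding area_def DV_length[OF v]
    using DV_nth_nonneg[OF v] by (intro sum.mono_neutral_right) (auto simp: order_le_less)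
  have "(\<Sum>i\<in>?U. 1) \<le> (\<Sum>i\<in>?U. v ! i)" by (rule sum_mono) auto
  then show "int (card ?U) \<le> area v" by (simp add: area)
  assume "p < n" "2 \<le> v ! p"
  then have "(\<Sum>i\<in>?U. 1) < (\<Sum>i\<in>?U. v ! i)" by (intro sum_strict_mono_ex1) force+
  then show "int (card ?U) < area v" by (simp add: area)
qed

lemma cross_zero_right:
  assumes "\<And>x. x \<in> set v \<Longrightarrow> x \<in> {0, 1}"
  shows "cross v [0] = length v"
  using assms by (induction v) (auto simp: cross_def)

text \<open>At this length the zeros are so many that all entries are 0 or 1, in which case a final
  0 forms a dinv pair with every entry and has step cost 0.\<close>

lemma card_level_append_zero:
  assumes n: "a + int k + 1 \<le> int n" and a: "0 \<le> a"
  shows "card (level (Suc n) k a) = card (level n k a)"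
proof -
  have "level (Suc n) k a = (\<lambda>v. v @ [0]) ` level n k a"
  proof
    show "(\<lambda>v. v @ [0]) ` level n k a \<subseteq> level (Suc n) k a"
    proof
      fix w assume "w \<in> (\<lambda>v. v @ [0]) ` level n k a"
      then obtain v where v: "v \<in> level n k a" "w = v @ [0]" by blast
      note vD = levelD[OF v(1)]
      \<comment> \<open>The strict bound on the number of nonzero entries is essential, as
        \<open>v\<close> has only length \<open>n\<close>.\<close>
      have lt2: "v ! i < 2" if "i < n" for i
        using length_le_nonzeros[OF vD(1) that] card_nonzero_le_area(2)[OF vD(1) that] vD(2,3) n
        by linarith
      have "x \<in> {0, 1}" if "x \<in> set v" for x
      proof -
        have "\<exists>i<length v. v ! i = x" using that by (simp add: in_set_conv_nth)
        then obtain i where i: "i < n" "x = v ! i" using vD(5) by auto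
        have "x < 2" "0 \<le> x"
          unfolding i(2) using lt2[OF i(1)] DV_nth_nonneg[OF vD(1) i(1)] by blast+
        then have "x = 0 \<or> x = 1" by arith
        then show ?thesis by simp
      qed
      then have "cross v [0] = n" using vD(5) cross_zero_right[of v] by simp
      then have "deficit w = int k" using vD by (simp add: v(2) deficit_snoc step_cost_def)
      moreover have "w \<in> DV (Suc n)"
      proof -
        have "v \<noteq> []" using vD(5) n a by auto
        then have "0 \<le> last v" using DV_set_nonneg[OF vD(1)] by simp
        then show ?thesis using vD(1) unfolding v(2) DV_snoc by simp
      qed
      ultimately show "w \<in> level (Suc n) k a"
        using vD(3) by (simp add: level_def v(2) area_conv_sum_list)
    qed
    show "level (Suc n) k a \<subseteq> (\<lambda>v. v @ [0]) ` level n k a"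
    proof
      fix w assume w: "w \<in> level (Suc n) k a"
      note wD = levelD[OF w]
      obtain v c where wv: "w = v @ [c]" using wD(5) by (cases w rule: rev_cases) auto
      have lenv: "length v = n" using wD(5) wv by simp
      have v: "v \<in> DV n" using wD(1) unfolding wv DV_snoc by simp
      \<comment> \<open>With length \<open>Suc n\<close> the weak bound suffices; it also excludes a
        positive last entry.\<close>
      have no: "\<not> (2 \<le> w ! p \<or> (p = Suc n - 1 \<and> 0 < w ! p))" if "p < Suc n" for p
        using length_le_nonzeros[OF wD(1) that] card_nonzero_le_area(1)[OF wD(1)] wD(2,3) n
        by linarith
      have "w ! n = c" using lenv by (simp add: wv nth_append)
      then have c: "c = 0" using no[of n] DV_nth_nonneg[OF wD(1), of n] by auto
      have "x \<in> {0, 1}" if "x \<in> set v" for x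
      proof -
        have "\<exists>i<length v. v ! i = x" using that by (simp add: in_set_conv_nth)
        then obtain i where i: "i < n" "x = v ! i" using lenv by auto
        then have "w ! i = x" using lenv by (simp add: wv nth_append)
        moreover have "w ! i < 2" "0 \<le> w ! i"
          using no[of i] DV_nth_nonneg[OF wD(1), of i] i(1) by auto
        ultimately have "x = 0 \<or> x = 1" by arith
        then show ?thesis by simp
      qed
      then have "cross v [0] = n" using lenv cross_zero_right[of v] by simp
      then have "deficit v = int k"
        using wD(2) lenv by (simp add: wv c deficit_snoc step_cost_def)
      moreover have "area v = a" using wD(3) by (simp add: wv c area_conv_sum_list)
      ultimately have "v \<in> level n k a" using v by (simp add: level_def)
      then show "w \<in> (\<lambda>v. v @ [0]) ` level n k a" using wv c by blast
    qed
  qed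
  moreover have "inj (\<lambda>v. v @ [0::int])" by (rule injI) simp
  ultimately show ?thesis by (simp add: card_image inj_on_subset)
qed

subsection \<open>Enumeration by prefix extension\<close>

definition extensions :: "int list \<Rightarrow> nat \<Rightarrow> int \<Rightarrow> int \<Rightarrow> int list set" where
  "extensions v j b a = {u. length u = j \<and> v @ u \<in> DV (length v + j) \<and>
     deficit (v @ u) = deficit v + b \<and> area (v @ u) = area v + a}"

lemma finite_extensions: "finite (extensions v j b a)"
proof (rule finite_imageD)
  show "finite ((@) v ` extensions v j b a)"
    by (rule finite_subset[OF _ finite_DV[of "length v + j"]]) (auto simp: extensions_def)
qed (simp add: inj_on_def)

text \<open>Step costs are nonnegative. This justifies pruning the enumeration once the deficit
  budget is negative.\<close>

lemma deficit_append_le: "v @ u \<in> DV (length v + length u) \<Longrightarrow> deficit v \<le> deficit (v @ u)"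
proof (induction u rule: rev_induct)
  case (snoc c u)
  then have *: "(v @ u) @ [c] \<in> DV (Suc (length v + length u))" by simp
  then have "v @ u \<in> DV (length v + length u)" unfolding DV_snoc by simp
  then show ?case
    using snoc.IH step_cost_nonneg[OF *] deficit_snoc[of "v @ u" c] by simp
qed simp

lemma extensions_neg_deficit: "b < 0 \<Longrightarrow> extensions v j b a = {}"
  using deficit_append_le by (force simp: extensions_def)

lemma extensions_neg_area: "a < 0 \<Longrightarrow> extensions v j b a = {}"
proof (rule equals0I)
  fix u assume a: "a < 0" and u: "u \<in> extensions v j b a"
  have "0 \<le> x" if "x \<in> set u" for x
    using u that by (intro DV_set_nonneg[of "v @ u"]) (auto simp: extensions_def)
  then have "0 \<le> sum_list u" by (rule sum_list_nonneg)
  then show False using a u by (simp add: extensions_def area_conv_sum_list)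
qed

lemma extensions_0: "v \<in> DV (length v) \<Longrightarrow> extensions v 0 b a = (if b = 0 \<and> a = 0 then {[]} else {})"
  by (auto simp: extensions_def)

lemma extensions_Suc:
  assumes "v \<in> DV (length v)" "v \<noteq> []"
  shows "extensions v (Suc j) b a =
    (\<Union>c\<in>{0..last v + 1}. (#) c ` extensions (v @ [c]) j (b - step_cost v c) (a - c))" (is "?L = ?R")
proof
  show "?L \<subseteq> ?R"
  proof
    fix u assume u: "u \<in> ?L"
    then obtain c u' where cu: "u = c # u'" by (cases u) (auto simp: extensions_def)
    have "(v @ [c]) @ u' \<in> DV (length (v @ [c]) + length u')"
      using u by (auto simp: extensions_def cu)
    then have "v @ [c] \<in> DV (Suc (length v))" using DV_append_left by fastforce
    then have "c \<in> {0..last v + 1}" using assms(2) unfolding DV_snoc by simp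
    moreover have "u' \<in> extensions (v @ [c]) j (b - step_cost v c) (a - c)"
      using u by (auto simp: extensions_def cu deficit_snoc area_conv_sum_list)
    ultimately show "u \<in> ?R" using cu by blast
  qed
  show "?R \<subseteq> ?L"
    by (auto simp: extensions_def deficit_snoc area_conv_sum_list)
qed

lemma card_extensions_Suc:
  assumes "v \<in> DV (length v)" "v \<noteq> []" "last v = int l"
  shows "card (extensions v (Suc j) b a) =
    (\<Sum>t<Suc (Suc l). card (extensions (v @ [int t]) j (b - step_cost v (int t)) (a - int t)))"
proof -
  let ?E = "\<lambda>c. extensions (v @ [c]) j (b - step_cost v c) (a - c)"
  have "card (extensions v (Suc j) b a) = (\<Sum>c\<in>{0..last v + 1}. card ((#) c ` ?E c))"
    unfolding extensions_Suc[OF assms(1,2)]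
    by (rule card_UN_disjoint) (auto intro: finite_imageI finite_extensions)
  also have "\<dots> = (\<Sum>c\<in>{0..last v + 1}. card (?E c))"
    by (intro sum.cong refl card_image) simp
  also have "\<dots> = (\<Sum>t<Suc (Suc l). card (?E (int t)))"
  proof (rule sum.reindex_cong)
    show "inj_on int {..<Suc (Suc l)}" by simp
    show "{0..last v + 1} = int ` {..<Suc (Suc l)}"
    proof
      show "{0..last v + 1} \<subseteq> int ` {..<Suc (Suc l)}"
      proof
        fix x assume "x \<in> {0..last v + 1}"
        then show "x \<in> int ` {..<Suc (Suc l)}"
          using assms(3) by (intro image_eqI[of _ _ "nat x"]) auto
      qed
    qed (use assms(3) in auto)
  qed simp
  finally show ?thesis .
qed

section \<open>The counting program on coefficient lists\<close>

text \<open>Lists stand for finitely supported sequences, with 0 beyond the end. In this reading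
  \<open>add_lists\<close> is addition of polynomials in the area variable and
  \<open>shift_list\<close> is multiplication by that variable.\<close>

fun entry :: "int list \<Rightarrow> nat \<Rightarrow> int" where
  "entry [] i = 0"
| "entry (x # xs) 0 = x"
| "entry (x # xs) (Suc i) = entry xs i"

fun add_lists :: "int list \<Rightarrow> int list \<Rightarrow> int list" where
  "add_lists [] ys = ys"
| "add_lists (x # xs) [] = x # xs"
| "add_lists (x # xs) (y # ys) = (x + y) # add_lists xs ys"

fun shift_list :: "int list \<Rightarrow> int list" where
  "shift_list [] = []"
| "shift_list (x # xs) = 0 # x # xs"

fun incr_entry :: "int list \<Rightarrow> nat \<Rightarrow> int list" where
  "incr_entry [] 0 = [1]"
| "incr_entry [] (Suc c) = 0 # incr_entry [] c"
| "incr_entry (x # xs) 0 = (x + 1) # xs"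
| "incr_entry (x # xs) (Suc c) = x # incr_entry xs c"

fun sum_first_two :: "int list \<Rightarrow> int" where
  "sum_first_two [] = 0"
| "sum_first_two [x] = x"
| "sum_first_two (x # y # xs) = x + y"

text \<open>A prefix of length \<open>L\<close> enters \<open>count_extensions j L b A cs l\<close> only through its last entry \<open>l\<close> and the
  list \<open>cs\<close> of the multiplicities of its entries \<open>0, 1, \<dots>\<close>. The result lists, by added area, the
  numbers of extensions by \<open>j\<close> entries that add \<open>b\<close> to the deficit; added areas above \<open>A\<close> may be
  cut off.\<close>

primrec count_children ::
  "(int \<Rightarrow> int \<Rightarrow> int list \<Rightarrow> nat \<Rightarrow> int list) \<Rightarrow> nat \<Rightarrow> int \<Rightarrow> int \<Rightarrow> int list \<Rightarrow> int list \<Rightarrow> nat \<Rightarrow> int list"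
where
  "count_children g 0 A s cs ds c = []"
| "count_children g (Suc i) A s cs ds c =
    add_lists
      (let b = s + sum_first_two ds in if b < 0 then [] else g b A (incr_entry cs c) c)
      (if A \<le> 0 then [] else shift_list (count_children g i (A - 1) (s + 1) cs (tl ds) (Suc c)))"

primrec count_extensions :: "nat \<Rightarrow> int \<Rightarrow> int \<Rightarrow> int \<Rightarrow> int list \<Rightarrow> nat \<Rightarrow> int list" where
  "count_extensions 0 L b A cs l = (if b = 0 then [1] else [])"
| "count_extensions (Suc j) L b A cs l =
    count_children (count_extensions j (L + 1)) (Suc (Suc l)) A (b - L) cs cs 0"

lemma entry_add_lists: "entry (add_lists xs ys) i = entry xs i + entry ys i"
proof (induction xs ys arbitrary: i rule: add_lists.induct)
  case (3 x xs y ys)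
  then show ?case by (cases i) auto
qed auto

lemma entry_shift_list: "entry (shift_list xs) i = (case i of 0 \<Rightarrow> 0 | Suc i' \<Rightarrow> entry xs i')"
  by (cases xs; cases i) auto

lemma entry_incr_entry: "entry (incr_entry xs c) i = entry xs i + (if i = c then 1 else 0)"
proof (induction xs c arbitrary: i rule: incr_entry.induct)
  case 1
  then show ?case by (cases i) auto
next
  case (2 c)
  then show ?case by (cases i) auto
next
  case (3 x xs)
  then show ?case by (cases i) auto
next
  case (4 x xs c)
  then show ?case by (cases i) auto
qed

lemma entry_drop: "entry (drop c xs) i = entry xs (c + i)"
proof (induction xs arbitrary: c)
  case (Cons x xs)
  then show ?case by (cases c) auto
qed simp

lemma sum_first_two_drop: "sum_first_two (drop c xs) = entry xs c + entry xs (Suc c)"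
proof -
  have "sum_first_two ys = entry ys 0 + entry ys (Suc 0)" for ys
    by (cases ys rule: sum_first_two.cases) auto
  then show ?thesis by (simp add: entry_drop)
qed

text \<open>The candidates \<open>c, c + 1, ...\<close> for the next entry are summed as in Horner's
  scheme: each recursive call shifts once, so the table of the candidate at offset \<open>t\<close>
  is shifted by \<open>t\<close>. \<open>G\<close> is the true count; its vanishing at negative
  arguments justifies both cut-offs.\<close>

lemma count_children_correct:
  assumes g: "\<And>c b A a. 0 \<le> b \<Longrightarrow> int a \<le> A \<Longrightarrow> c < m \<Longrightarrow>
      entry (g b A (incr_entry cs c) c) a = G c b (int a)"
    and neg: "\<And>c b a. b < 0 \<Longrightarrow> G c b a = 0" "\<And>c b a. a < 0 \<Longrightarrow> G c b a = 0"
  shows "c + i \<le> m \<Longrightarrow> int a \<le> A \<Longrightarrow>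
    entry (count_children g i A (s + int c) cs (drop c cs) c) a =
    (\<Sum>t<i. G (c + t) (s + int (c + t) + sum_first_two (drop (c + t) cs)) (int a - int t))"
proof (induction i arbitrary: c A a)
  case (Suc i)
  let ?G = "\<lambda>c. G c (s + int c + sum_first_two (drop c cs))"
  let ?r = "if A \<le> 0 then []
    else shift_list (count_children g i (A - 1) (s + int c + 1) cs (tl (drop c cs)) (Suc c))"
  have first: "entry (let b = s + int c + sum_first_two (drop c cs)
      in if b < 0 then [] else g b A (incr_entry cs c) c) a = ?G c (int a)"
    using g[of "s + int c + sum_first_two (drop c cs)" a A c] Suc.prems neg(1) by (auto simp: Let_def)
  have rest: "entry ?r a = (\<Sum>t<i. ?G (Suc c + t) (int a - int (Suc t)))"
  proof (cases a)
    case 0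
    then have "(\<Sum>t<i. ?G (Suc c + t) (int a - int (Suc t))) = 0"
      \<comment> \<open>All later candidates add at least one to the area, so they contribute
        nothing at area 0.\<close>
      by (intro sum.neutral ballI neg(2)) simp
    then show ?thesis using 0 by (simp add: entry_shift_list)
  next
    case a: (Suc a')
    then have "\<not> A \<le> 0" using Suc.prems by simp
    then have "entry ?r a =
        entry (count_children g i (A - 1) (s + int (Suc c)) cs (drop (Suc c) cs) (Suc c)) a'"
      by (simp add: a entry_shift_list drop_Suc tl_drop ac_simps)
    also have "\<dots> = (\<Sum>t<i. ?G (Suc c + t) (int a' - int t))"
      using Suc.IH[of "Suc c" a' "A - 1"] Suc.prems a by simp
    finally show ?thesis by (simp add: a)
  qed
  show ?case
    unfolding sum.lessThan_Suc_shift count_children.simps(2) entry_add_lists first rest by simp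
qed simp

lemma cross_single_eq_count: "cross v [c] = count_list v c + count_list v (c + 1)"
  by (induction v) (auto simp: cross_def)

text \<open>The multiplicities suffice as state because \<open>cross v [c]\<close> is the
  multiplicity of \<open>c\<close> plus that of \<open>c + 1\<close>, which is what
  \<open>sum_first_two\<close> reads off.\<close>

lemma count_extensions_correct:
  assumes "v \<in> DV (length v)" "v \<noteq> []" "last v = int l" "L = int (length v)"
    and "\<And>i. entry cs i = int (count_list v (int i))" and "int a \<le> A"
  shows "entry (count_extensions j L b A cs l) a = int (card (extensions v j b (int a)))"
  using assms
proof (induction j arbitrary: v l L cs b a A)
  case 0
  then show ?case by (cases a) (simp_all add: extensions_0)
next
  case (Suc j)
  define G where "G c b a = int (card (extensions (v @ [int c]) j b a))" for c b a
  have "entry (count_extensions (Suc j) L b A cs l) a =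
      entry (count_children (count_extensions j (L + 1)) (Suc (Suc l)) A (b - L + int 0) cs (drop 0 cs) 0) a"
    by simp
  also have "\<dots> = (\<Sum>t<Suc (Suc l). G (0 + t) (b - L + int (0 + t) + sum_first_two (drop (0 + t) cs))
      (int a - int t))"
  proof (rule count_children_correct[where m = "Suc (Suc l)"])
    fix c :: nat and b A :: int and a :: nat
    assume "0 \<le> b" "int a \<le> A" "c < Suc (Suc l)"
    show "entry (count_extensions j (L + 1) b A (incr_entry cs c) c) a = G c b (int a)"
      unfolding G_def
    proof (rule Suc.IH)
      show "v @ [int c] \<in> DV (length (v @ [int c]))"
        using Suc.prems(1-3) \<open>c < Suc (Suc l)\<close> by (simp add: DV_snoc)
      show "entry (incr_entry cs c) i = int (count_list (v @ [int c]) (int i))" for i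
        using Suc.prems(5) by (simp add: entry_incr_entry)
    qed (use Suc.prems(4) \<open>int a \<le> A\<close> in auto)
  qed (use Suc.prems(6) in \<open>auto simp: G_def extensions_neg_deficit extensions_neg_area\<close>)
  also have "\<dots> = (\<Sum>t<Suc (Suc l). G t (b - step_cost v (int t)) (int a - int t))"
  proof (rule sum.cong[OF refl])
    fix t assume "t \<in> {..<Suc (Suc l)}"
    have "sum_first_two (drop t cs) = int (cross v [int t])"
      by (simp add: sum_first_two_drop Suc.prems(5) cross_single_eq_count add.commute)
    then show "G (0 + t) (b - L + int (0 + t) + sum_first_two (drop (0 + t) cs)) (int a - int t) =
        G t (b - step_cost v (int t)) (int a - int t)"
      by (simp add: step_cost_def Suc.prems(4) algebra_simps)
  qed
  also have "\<dots> = int (card (extensions v (Suc j) b (int a)))"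
    unfolding card_extensions_Suc[OF Suc.prems(1-3)] G_def by simp
  finally show ?case .
qed

section \<open>Tables and finite checks\<close>

text \<open>The enumeration starts from the forced prefix \<open>[0]\<close>, so index
  \<open>j\<close> belongs to length \<open>Suc j\<close>.\<close>

definition area_table :: "nat \<Rightarrow> nat \<Rightarrow> nat \<Rightarrow> int list" where
  "area_table j k A = count_extensions j 1 (int k) (int A) [1] 0"

lemma entry_area_table:
  assumes "a \<le> A"
  shows "entry (area_table j k A) a = int (card (level (Suc j) k (int a)))"
proof -
  have zero: "[0] \<in> DV (Suc 0)" by (simp add: DV_def)
  have def0: "deficit [0] = 0" "area [0] = 0" by (simp_all add: deficit_def area_def)
  have "level (Suc j) k (int a) = (#) 0 ` extensions [0] j (int k) (int a)" (is "?L = ?R")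
  proof
    show "?L \<subseteq> ?R"
    proof
      fix v assume v: "v \<in> ?L"
      then obtain x u where "v = x # u" using levelD(5) by (cases v) fastforce+
      moreover from this have "x = 0" using DV_nth_0[OF levelD(1)[OF v]] by simp
      ultimately show "v \<in> ?R" using v by (auto simp: level_def extensions_def def0 DV_def)
    qed
    show "?R \<subseteq> ?L" by (auto simp: level_def extensions_def def0)
  qed
  then have "card (level (Suc j) k (int a)) = card (extensions [0] j (int k) (int a))"
    by (simp add: card_image)
  moreover have "entry [1] i = int (count_list [0] (int i))" for i by (cases i) auto
  ultimately show ?thesis
    using count_extensions_correct[of "[0]" 0 1 "[1]" a "int A" j "int k"] zero assms
    by (simp add: area_table_def)
qed

text \<open>This is \<open>n choose 2\<close> in a form suited to evaluation.\<close>

primrec triangle :: "nat \<Rightarrow> nat" where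
  "triangle 0 = 0"
| "triangle (Suc n) = n + triangle n"

lemma triangle_eq_choose: "triangle n = n choose 2"
  by (induction n) (simp_all add: numeral_2_eq_2)

definition is_palindrome :: "'a list \<Rightarrow> bool" where
  "is_palindrome xs \<longleftrightarrow> rev xs = xs"

definition symmetric_table :: "nat \<Rightarrow> nat \<Rightarrow> bool" where
  "symmetric_table k j \<longleftrightarrow> (let D = triangle (Suc j) - k in
    is_palindrome (map (entry (area_table j k D)) [0..<Suc D]))"

text \<open>These are the lengths from 1 to \<open>k + 3\<close>.\<close>

definition all_symmetric_tables :: "nat \<Rightarrow> bool" where
  "all_symmetric_tables k \<longleftrightarrow> list_all (symmetric_table k) [0..<k + 3]"

definition all_equal :: "'a list \<Rightarrow> bool" where
  "all_equal xs \<longleftrightarrow> list_all ((=) (hd xs)) xs"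

definition flat_table :: "nat \<Rightarrow> bool" where
  "flat_table k \<longleftrightarrow> (let T = triangle (Suc k) in
    all_equal (map (entry (area_table (k + 2) k T)) [k..<Suc T]))"

definition stable_table :: "nat \<Rightarrow> nat \<Rightarrow> bool" where
  "stable_table k j \<longleftrightarrow>
    map (entry (area_table j k k)) [0..<Suc k] = map (entry (area_table (k + 2) k k)) [0..<Suc k]"

text \<open>These are the lengths from \<open>k + 4\<close> to \<open>2 * k + 1\<close>, each
  compared with length \<open>k + 3\<close>.\<close>

definition all_stable_tables :: "nat \<Rightarrow> bool" where
  "all_stable_tables k \<longleftrightarrow> list_all (stable_table k) [k + 3..<2 * k + 1]"

text \<open>The bound \<open>k \<le> 9\<close> enters the proof only through the range of this
  computation and the next two.\<close>

lemma all_symmetric_tables_computed: "list_all all_symmetric_tables [0..<10]"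
  by code_simp

lemma flat_tables_computed: "list_all flat_table [0..<10]"
  by code_simp

lemma all_stable_tables_computed: "list_all all_stable_tables [0..<10]"
  by code_simp

subsection \<open>Symmetry\<close>

lemma is_palindrome_map_upt:
  assumes "is_palindrome (map f [0..<Suc d])" and "i \<le> d"
  shows "f i = f (d - i)"
proof -
  have "rev (map f [0..<Suc d]) ! i = map f [0..<Suc d] ! (d - i)"
    using assms(2) by (subst rev_nth) (simp_all del: upt_Suc)
  then show ?thesis using assms unfolding is_palindrome_def by (simp del: upt_Suc)
qed

lemma card_level_symmetric_short:
  assumes k: "k \<le> 9" and n: "0 < n" "n \<le> k + 3" and a: "0 \<le> a" "a + int k \<le> int (n choose 2)"
  shows "card (level n k a) = card (level n k (int (n choose 2) - int k - a))"
proof -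
  obtain j where j: "n = Suc j" using n by (cases n) auto
  define d where "d = (n choose 2) - k"
  have "all_symmetric_tables k"
    using all_symmetric_tables_computed k by (auto simp: list_all_iff)
  then have "symmetric_table k j" using n j by (auto simp: all_symmetric_tables_def list_all_iff)
  then have "is_palindrome (map (entry (area_table j k d)) [0..<Suc d])"
    unfolding symmetric_table_def Let_def triangle_eq_choose d_def j .
  moreover have "nat a \<le> d" using a by (simp add: d_def)
  ultimately have "entry (area_table j k d) (nat a) = entry (area_table j k d) (d - nat a)"
    by (rule is_palindrome_map_upt)
  then have "card (level n k (int (nat a))) = card (level n k (int (d - nat a)))"
    using \<open>nat a \<le> d\<close> by (simp add: entry_area_table j)
  moreover have "int (nat a) = a" "int (d - nat a) = int (n choose 2) - int k - a"
    using a \<open>nat a \<le> d\<close> by (auto simp: d_def)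
  ultimately show ?thesis by simp
qed

lemma card_level_flat:
  assumes k: "k \<le> 9" and a: "int k \<le> a" "a \<le> int (Suc k choose 2)"
  shows "card (level (k + 3) k a) = card (level (k + 3) k (int k))"
proof -
  let ?T = "area_table (k + 2) k (triangle (Suc k))"
  have kT: "k \<le> triangle (Suc k)" using a by (simp add: triangle_eq_choose)
  have "flat_table k" using flat_tables_computed k by (auto simp: list_all_iff)
  then have "all_equal (map (entry ?T) [k..<Suc (triangle (Suc k))])" by (simp add: flat_table_def Let_def)
  moreover have "hd (map (entry ?T) [k..<Suc (triangle (Suc k))]) = entry ?T k"
    using kT by (simp add: hd_map del: upt_Suc)
  moreover have "nat a \<in> set [k..<Suc (triangle (Suc k))]"
    using a kT by (auto simp: triangle_eq_choose)
  ultimately have "entry ?T (nat a) = entry ?T k"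
    unfolding all_equal_def list_all_iff set_map by (metis imageI)
  moreover have "nat a \<le> triangle (Suc k)" "int (nat a) = a" "Suc (k + 2) = k + 3"
    using a by (auto simp: triangle_eq_choose)
  ultimately show ?thesis using kT entry_area_table[of _ _ "k + 2" k] by (metis of_nat_eq_iff)
qed

text \<open>Up to length \<open>2 * k + 1\<close> the tables are compared directly; from there on
  \<open>a \<le> k\<close> permits appending zeros.\<close>

lemma card_level_low_area:
  assumes k: "k \<le> 9" and n: "k + 3 \<le> n" and a: "0 \<le> a" "a \<le> int k"
  shows "card (level n k a) = card (level (k + 3) k a)"
  using n
proof (induction n rule: dec_induct)
  case (step m)
  show ?case
  proof (cases "2 * k + 1 \<le> m")
    case True
    then have "card (level (Suc m) k a) = card (level m k a)"
      using a by (intro card_level_append_zero) auto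
    then show ?thesis using step by simp
  next
    case False
    have "all_stable_tables k" using all_stable_tables_computed k by (auto simp: list_all_iff)
    moreover have "m \<in> set [k + 3..<2 * k + 1]" using False step.hyps by auto
    ultimately have "stable_table k m" unfolding all_stable_tables_def list_all_iff by blast
    then have "entry (area_table m k k) (nat a) = entry (area_table (k + 2) k k) (nat a)"
      using a by (auto simp: stable_table_def simp del: upt_Suc)
    moreover have "nat a \<le> k" "int (nat a) = a" "Suc (k + 2) = k + 3" using a by auto
    ultimately show ?thesis using entry_area_table[of "nat a" k] by (metis of_nat_eq_iff)
  qed
qed simp

text \<open>Here \<open>d\<close> is the dinv. Passing from \<open>m\<close> to \<open>Suc m\<close>
  raises both the binomial and the area by \<open>m\<close>, so \<open>d\<close> stays
  fixed.\<close>

lemma card_level_low_dinv: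
  assumes n: "k + 3 \<le> n" and d: "d \<le> int (Suc k choose 2)"
  shows "card (level n k (int (n choose 2) - int k - d)) =
    card (level (k + 3) k (int ((k + 3) choose 2) - int k - d))"
  using n
proof (induction n rule: dec_induct)
  case (step m)
  have eq: "int (Suc m choose 2) - int k - d = (int (m choose 2) - int k - d) + int m"
    by (simp add: numeral_2_eq_2)
  have "card (level (Suc m) k (int (m choose 2) - int k - d + int m)) =
      card (level m k (int (m choose 2) - int k - d))"
    by (rule card_level_shift) (use step d in auto)
  then show ?case unfolding eq using step.IH by (rule trans)
qed simp

lemma card_level_antimono:
  assumes n: "k + 3 \<le> n" and a: "int k \<le> a" "a \<le> b"
    and b: "b + int k + int (Suc k choose 2) \<le> int (n choose 2)"
  shows "card (level n k b) \<le> card (level n k a)"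
  using a(2) b
proof (induction b rule: int_ge_induct)
  case (step b)
  then have "card (level n k (b + 1)) \<le> card (level n k b)"
    using card_level_le[OF n, of "b + 1"] a by simp
  then show ?case using step by simp
qed simp

lemma card_level_symmetric:
  assumes k: "k \<le> 9" and a: "0 \<le> a" "a + int k \<le> int (n choose 2)"
  shows "card (level n k a) = card (level n k (int (n choose 2) - int k - a))"
proof -
  consider "n = 0" | "0 < n" "n \<le> k + 3" | "k + 3 \<le> n" by linarith
  then show ?thesis
  proof cases
    case 1
    then have "a = 0" "k = 0" using a by (auto simp: numeral_2_eq_2)
    then show ?thesis using 1 by (simp add: numeral_2_eq_2)
  next
    case 2
    then show ?thesis using card_level_symmetric_short[OF k _ _ a] by blast
  next
    case n: 3
    define N where "N = (\<lambda>a. card (level n k a))"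
    define N0 where "N0 = (\<lambda>a. card (level (k + 3) k a))"
    define T where "T = int (Suc k choose 2)"
    define D where "D = int (n choose 2) - int k"
    define D0 where "D0 = int ((k + 3) choose 2) - int k"
    have choose: "(k + 3) choose 2 = 2 * k + (Suc k choose 2) + 3"
      by (simp add: numeral_2_eq_2 numeral_3_eq_3)
    have D0: "D0 = int k + T + 3" using choose by (simp add: D0_def T_def)
    have D: "D0 \<le> D" using choose_two_mono[OF n] by (simp add: D0_def D_def)
    have kT: "int k \<le> T" by (simp add: T_def numeral_2_eq_2)
    have sym0: "N0 a = N0 (D0 - a)" if "0 \<le> a" "a \<le> D0" for a
      using card_level_symmetric_short[OF k, of "k + 3" a] that by (simp add: N0_def D0_def)
    have flat0: "N0 a = N0 (int k)" if "int k \<le> a" "a \<le> T" for a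
      using card_level_flat[OF k, of a] that by (simp add: N0_def T_def)
    have low_area: "N a = N0 a" if "0 \<le> a" "a \<le> int k" for a
      using card_level_low_area[OF k n, of a] that by (simp add: N_def N0_def)
    have low_dinv: "N (D - d) = N0 (D0 - d)" if "d \<le> T" for d
      using card_level_low_dinv[OF n, of d] that by (simp add: N_def N0_def D_def D0_def T_def)
    \<comment> \<open>Vectors of dinv \<open>d\<close> are transported to length
      \<open>k + 3\<close>, where the computed symmetry trades dinv for area.\<close>
    have ends: "N (D - d) = N0 d" if "0 \<le> d" "d \<le> T" for d
      using low_dinv[OF that(2)] sym0[of d] that D0 by simp
    \<comment> \<open>Up to \<open>D - T\<close> monotonicity squeezes \<open>N a\<close> between
      two equal end values; beyond that, the dinv \<open>D - a\<close> lies between \<open>k\<close>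
      and \<open>T\<close>, where \<open>N0\<close> is flat.\<close>
    have middle: "N a = N0 (int k)" if a: "int k \<le> a" "a \<le> D - int k" for a
    proof (cases "a \<le> D - T")
      case True
      have "N a \<le> N (int k)"
        unfolding N_def using card_level_antimono[OF n _ a(1)] True by (simp add: D_def T_def)
      moreover have "N (D - T) \<le> N a"
        unfolding N_def using card_level_antimono[OF n a(1) True] by (simp add: D_def T_def)
      moreover have "N (D - T) = N0 (int k)" using ends[of T] flat0[of T] kT by simp
      moreover have "N (int k) = N0 (int k)" using low_area[of "int k"] by simp
      ultimately show ?thesis by simp
    next
      case False
      then show ?thesis using ends[of "D - a"] flat0[of "D - a"] a by simp
    qed
    have aD: "0 \<le> a" "a \<le> D" using a by (auto simp: D_def)
    have "a < int k \<or> D - int k < a \<or> int k \<le> a \<and> a \<le> D - int k" by linarith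
    then have "N a = N (D - a)"
    proof (elim disjE)
      assume "a < int k"
      then show ?thesis using low_area[of a] ends[of a] aD kT by simp
    next
      assume "D - int k < a"
      then show ?thesis using low_area[of "D - a"] ends[of "D - a"] aD kT by simp
    next
      assume "int k \<le> a \<and> a \<le> D - int k"
      then show ?thesis using middle[of a] middle[of "D - a"] by simp
    qed
    then show ?thesis by (simp add: N_def D_def)
  qed
qed

text \<open>Fixed length and deficit make dinv the complement \<open>d - a\<close> of the area, so
  symmetry of the polynomial becomes symmetry of the level sizes under
  \<open>a \<mapsto> d - a\<close>.\<close>

lemma Cat_eq_sum_levels:
  assumes "k \<le> n choose 2"
  defines "d \<equiv> (n choose 2) - k"
  shows "Cat n k q t = (\<Sum>a\<le>d. of_nat (card (level n k (int a))) * (q ^ a * t ^ (d - a)))"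
proof -
  let ?S = "{v. v \<in> DV n \<and> deficit v = int k}"
  have dinv: "int (dinv v) = int (n choose 2) - int k - area v" if "v \<in> ?S" for v
    using that by (auto simp: deficit_def DV_length)
  have level: "{v \<in> ?S. nat (area v) = a} = level n k (int a)" for a
    using area_nonneg by (auto simp: level_def)
  have "(\<Sum>v\<in>?S. q ^ nat (area v) * t ^ dinv v) =
      (\<Sum>a\<in>{..d}. \<Sum>v\<in>{v \<in> ?S. nat (area v) = a}. q ^ nat (area v) * t ^ dinv v)"
  proof (rule sum.group[symmetric])
    show "(\<lambda>v. nat (area v)) ` ?S \<subseteq> {..d}" using dinv assms by fastforce
  qed (use finite_DV in auto)
  also have "\<dots> = (\<Sum>a\<le>d. \<Sum>v\<in>level n k (int a). q ^ a * t ^ (d - a))"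
    unfolding level
  proof (intro sum.cong refl)
    fix a v assume "a \<in> {..d}" "v \<in> level n k (int a)"
    moreover from this have "dinv v = d - a" "nat (area v) = a"
      using levelD(3,4)[of v n k "int a"] assms by auto
    ultimately show "q ^ nat (area v) * t ^ dinv v = q ^ a * t ^ (d - a)" by simp
  qed
  finally show ?thesis by (simp add: Cat_def)
qed

theorem theorem1p6:
  fixes n k :: nat
  assumes "k \<le> 9"
  shows "Cat n k q_var t_var = Cat n k t_var q_var"
proof (cases "k \<le> n choose 2")
  case True
  define d where "d = (n choose 2) - k"
  define N where "N a = card (level n k (int a))" for a
  have sym: "N (d - a) = N a" if "a \<le> d" for a
  proof -
    have "int (d - a) = int (n choose 2) - int k - int a" using that True by (simp add: d_def)
    then show ?thesis using card_level_symmetric[OF assms, of "int a" n] that True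
      by (simp add: d_def N_def)
  qed
  have "(\<Sum>a\<le>d. of_nat (N a) * (q_var ^ a * t_var ^ (d - a))) =
      (\<Sum>a\<le>d. of_nat (N a) * (t_var ^ a * q_var ^ (d - a)))"
    by (rule sum.reindex_bij_witness[of _ "\<lambda>a. d - a" "\<lambda>a. d - a"]) (auto simp: sym mult.commute)
  then show ?thesis unfolding Cat_eq_sum_levels[OF True] d_def N_def .
next
  case False
  \<comment> \<open>Area and dinv are nonnegative, so no deficit exceeds \<open>n choose 2\<close>
    and both sums are empty.\<close>
  have "deficit v \<noteq> int k" if "v \<in> DV n" for v
    using that area_nonneg[OF that] False by (auto simp: deficit_def DV_length)
  then have "{v. v \<in> DV n \<and> deficit v = int k} = {}" by auto
  then show ?thesis by (simp only: Cat_def sum.empty)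
qed

end
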